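(* Let $\vec f=(f_1,f_2):I=[0,1]\to\mathbb{R}^2$ be the continuous vector-valued function of the hidden variable recurrent fractal interpolation construction described in the context, with similitudes $L_{i,\gamma(i)}$, Lipschitz contractivity factors $s_i,s'_i,\tilde s_i,\tilde s'_i$ and Lipschitz functions $q_{i,\gamma(i)},\tilde q_{i,\gamma(i)}$. Suppose that $$\omega_k+\tilde\omega_k<\frac{l_L}{L_L}\qquad\text{for all }1\le k\le n.$$ Then there exist positive constants $L_1,L_2$ and $\tau_1,\tau_2$ with $0<\tau_1,\tau_2\le 1$ such that for all $x_1,x_2\in I$, $$|f_1(x_1)-f_1(x_2)|\le L_1|x_1-x_2|^{\tau_1},\qquad |f_2(x_1)-f_2(x_2)|\le L_2|x_1-x_2|^{\tau_2}.$$
   Context: Data and intervals. Let $P=\{(x_i,y_i,z_i)\in\mathbb{R}^3: i=0,1,\dots,n\}$ with $0=x_0<x_1<\dots<x_n=1$, and write $\vec y_i=(y_i,z_i)$. Put $I=[x_0,x_n]=[0,1]$ and $I_i=[x_{i-1},x_i]$ for $i=1,\dots,n$ (regions). Let $l$ be an integer with $2\le l\le n$, and for $k=1,\dots,l$ let $\tilde I_k=[x_{s(k)},x_{e(k)}]$ (domains) be subintervals with endpoints among the nodes $x_0,\dots,x_n$ and $e(k)-s(k)\ge 2$. For each $i\in\{1,\dots,n\}$ an index $\gamma(i)\in\{1,\dots,l\}$ is chosen. $|J|$ denotes the length of an interval $J$. Maps. For each $i$, with $k=\gamma(i)$, $L_{i,k}:\tilde I_k\to I_i$ is a contraction homeomorphism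 that is a similitude and maps endpoints to endpoints: $L_{i,k}(\{x_{s(k)},x_{e(k)}\})=\{x_{i-1},x_i\}$. The functions $s_i,s'_i,\tilde s_i,\tilde s'_i:I_i\to\mathbb{R}$ (contractivity factors) are Lipschitz with absolute values less than $1$. The functions $q_{i,k},\tilde q_{i,k}:\tilde I_k\to\mathbb{R}$ are Lipschitz and such that the map $$\vec F_{i,k}(x,(y,z))=\begin{pmatrix} s_i(L_{i,k}(x))\,y+s'_i(L_{i,k}(x))\,z+q_{i,k}(x)\\ \tilde s_i(L_{i,k}(x))\,y+\tilde s'_i(L_{i,k}(x))\,z+\tilde q_{i,k}(x)\end{pmatrix}$$ satisfies: if $\alpha\in\{s(k),e(k)\}$, $a\in\{i-1,i\}$ and $L_{i,k}(x_\alpha)=x_a$, then $\vec F_{i,k}(x_\alpha,\vec y_\alpha)=\vec y_a$. The function. $\vec f=(f_1,f_2):I\to\mathbb{R}^2$ is the unique continuous function with $\vec f(x_i)=\vec y_i$ for $i=0,\dots,n$ and $\vec f(x)=\vec F_{i,\gamma(i)}\big(L_{i,\gamma(i)}^{-1}(x),\vec f(L_{i,\gamma(i)}^{-1}(x))\big)$ for $x\in I_i$, $i=1,\dots,n$; i.e. for $x\in I_i$, $$f_1(x)=s_i(x)f_1(L_{i,\gamma(i)}^{-1}(x))+s'_i(x)f_2(L_{i,\gamma(i)}^{-1}(x))+q_{i,\gamma(i)}(L_{i,\gamma(i)}^{-1}(x)),$$ $$f_2(x)=\tilde s_i(x)f_1(L_{i,\gamma(i)}^{-1}(x))+\tilde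 s'_i(x)f_2(L_{i,\gamma(i)}^{-1}(x))+\tilde q_{i,\gamma(i)}(L_{i,\gamma(i)}^{-1}(x)).$$ $f_1$ is called the hidden variable recurrent fractal interpolation function (HVRFIF). Notation. For a function $g$, $\overline g=\max_x|g(x)|$. $\omega_k=\max\{\overline{s_k},\overline{s'_k}\}$, $\tilde\omega_k=\max\{\overline{\tilde s_k},\overline{\tilde s'_k}\}$, $$L_L=\max_{1\le k\le n}\frac{|I_k|}{|\tilde I_{\gamma(k)}|},\qquad l_L=\min_{1\le k\le n}\frac{|I_k|}{|\tilde I_{\gamma(k)}|}.$$ *)

theory Defs
  imports "HOL-Analysis.Analysis"
begin

definition region :: "(nat \<Rightarrow> real) \<Rightarrow> nat \<Rightarrow> real set" where
  "region x i = {x (i - 1)..x i}"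

definition dom_interval :: "(nat \<Rightarrow> real) \<Rightarrow> (nat \<Rightarrow> nat) \<Rightarrow> (nat \<Rightarrow> nat) \<Rightarrow> nat \<Rightarrow> real set" where
  "dom_interval x st en k = {x (st k)..x (en k)}"

definition lipschitz :: "real set \<Rightarrow> (real \<Rightarrow> real) \<Rightarrow> bool" where
  "lipschitz S g \<longleftrightarrow> (\<exists>C. C-lipschitz_on S g)"

definition contractive_similitude :: "real set \<Rightarrow> (real \<Rightarrow> real) \<Rightarrow> bool" where
  "contractive_similitude S g \<longleftrightarrow>
     (\<exists>r. 0 < r \<and> r < 1 \<and> (\<forall>u\<in>S. \<forall>v\<in>S. dist (g u) (g v) = r * dist u v))"

text \<open>The map \<open>F\<close> of a single index pair: \<open>s, s'\<close> are the factors of the first component,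
  \<open>t, t'\<close> those of the second one (written with a tilde in the literature), and
  \<open>q, r\<close> are the two additive terms.\<close>

definition hv_map ::
  "(real \<Rightarrow> real) \<Rightarrow> (real \<Rightarrow> real) \<Rightarrow> (real \<Rightarrow> real) \<Rightarrow> (real \<Rightarrow> real) \<Rightarrow> (real \<Rightarrow> real) \<Rightarrow>
   (real \<Rightarrow> real) \<Rightarrow> (real \<Rightarrow> real) \<Rightarrow> real \<Rightarrow> real \<times> real \<Rightarrow> real \<times> real" where
  "hv_map L s s' t t' q r u v =
     (s (L u) * fst v + s' (L u) * snd v + q u,
      t (L u) * fst v + t' (L u) * snd v + r u)"

text \<open>All functions are total on the type of reals; only their values on the region
  (for \<open>s, s', t, t'\<close>) or on the domain interval (for \<open>L, q, r\<close>) matter.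
  For \<open>L\<close>, \<open>q\<close>, \<open>r\<close> only the index pairs \<open>(i, \<gamma> i)\<close> are constrained.\<close>

locale hv_recurrent_system =
  fixes n :: nat
    and x y z :: "nat \<Rightarrow> real"
    and l :: nat
    and st en \<gamma> :: "nat \<Rightarrow> nat"
    and L :: "nat \<Rightarrow> nat \<Rightarrow> real \<Rightarrow> real"
    and s s' t t' :: "nat \<Rightarrow> real \<Rightarrow> real"
    and q r :: "nat \<Rightarrow> nat \<Rightarrow> real \<Rightarrow> real"
  assumes x_first: "x 0 = 0"
    and x_last: "x n = 1"
    and x_less: "\<And>i. i < n \<Longrightarrow> x i < x (Suc i)"
    and l_ge: "2 \<le> l"
    and l_le: "l \<le> n"
    and en_le: "\<And>k. k \<in> {1..l} \<Longrightarrow> en k \<le> n"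
    and st_en: "\<And>k. k \<in> {1..l} \<Longrightarrow> st k + 2 \<le> en k"
    and gamma_range: "\<And>i. i \<in> {1..n} \<Longrightarrow> \<gamma> i \<in> {1..l}"
    and L_homeo: "\<And>i. i \<in> {1..n} \<Longrightarrow>
      \<exists>h. homeomorphism (dom_interval x st en (\<gamma> i)) (region x i) (L i (\<gamma> i)) h"
    and L_simil: "\<And>i. i \<in> {1..n} \<Longrightarrow>
      contractive_similitude (dom_interval x st en (\<gamma> i)) (L i (\<gamma> i))"
    and L_ends: "\<And>i. i \<in> {1..n} \<Longrightarrow>
      L i (\<gamma> i) ` {x (st (\<gamma> i)), x (en (\<gamma> i))} = {x (i - 1), x i}"
    and factor_lipschitz: "\<And>i g. i \<in> {1..n} \<Longrightarrow> g \<in> {s i, s' i, t i, t' i} \<Longrightarrow>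
      lipschitz (region x i) g"
    and factor_less_1: "\<And>i g u. i \<in> {1..n} \<Longrightarrow> g \<in> {s i, s' i, t i, t' i} \<Longrightarrow>
      u \<in> region x i \<Longrightarrow> \<bar>g u\<bar> < 1"
    and term_lipschitz: "\<And>i g. i \<in> {1..n} \<Longrightarrow> g \<in> {q i (\<gamma> i), r i (\<gamma> i)} \<Longrightarrow>
      lipschitz (dom_interval x st en (\<gamma> i)) g"
    and F_ends: "\<And>i \<alpha> a. i \<in> {1..n} \<Longrightarrow> \<alpha> \<in> {st (\<gamma> i), en (\<gamma> i)} \<Longrightarrow> a \<in> {i - 1, i} \<Longrightarrow>
      L i (\<gamma> i) (x \<alpha>) = x a \<Longrightarrow>
      hv_map (L i (\<gamma> i)) (s i) (s' i) (t i) (t' i) (q i (\<gamma> i)) (r i (\<gamma> i)) (x \<alpha>) (y \<alpha>, z \<alpha>)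
        = (y a, z a)"

locale hv_recurrent_fif = hv_recurrent_system +
  fixes f :: "real \<Rightarrow> real \<times> real"
  assumes f_cont: "continuous_on {0..1} f"
    and f_interp: "\<And>i. i \<le> n \<Longrightarrow> f (x i) = (y i, z i)"
    and f_eq: "\<And>i u. i \<in> {1..n} \<Longrightarrow> u \<in> region x i \<Longrightarrow>
      f u = (let v = inv_into (dom_interval x st en (\<gamma> i)) (L i (\<gamma> i)) u in
        hv_map (L i (\<gamma> i)) (s i) (s' i) (t i) (t' i) (q i (\<gamma> i)) (r i (\<gamma> i)) v (f v))"

text \<open>On the compact regions the supremum below is attained for the continuous factors.\<close>

definition sup_abs :: "real set \<Rightarrow> (real \<Rightarrow> real) \<Rightarrow> real" where
  "sup_abs S g = (SUP u\<in>S. \<bar>g u\<bar>)"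

text \<open>Used for both components: \<open>\<omega>\<^sub>k\<close> from \<open>s, s'\<close> and its tilde variant from \<open>t, t'\<close>.\<close>

definition omega ::
  "(nat \<Rightarrow> real) \<Rightarrow> (nat \<Rightarrow> real \<Rightarrow> real) \<Rightarrow> (nat \<Rightarrow> real \<Rightarrow> real) \<Rightarrow> nat \<Rightarrow> real" where
  "omega x g g' k = max (sup_abs (region x k) (g k)) (sup_abs (region x k) (g' k))"

definition length_ratio ::
  "(nat \<Rightarrow> real) \<Rightarrow> (nat \<Rightarrow> nat) \<Rightarrow> (nat \<Rightarrow> nat) \<Rightarrow> (nat \<Rightarrow> nat) \<Rightarrow> nat \<Rightarrow> real" where
  "length_ratio x st en \<gamma> k = (x k - x (k - 1)) / (x (en (\<gamma> k)) - x (st (\<gamma> k)))"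

definition max_ratio ::
  "nat \<Rightarrow> (nat \<Rightarrow> real) \<Rightarrow> (nat \<Rightarrow> nat) \<Rightarrow> (nat \<Rightarrow> nat) \<Rightarrow> (nat \<Rightarrow> nat) \<Rightarrow> real" where
  "max_ratio n x st en \<gamma> = Max (length_ratio x st en \<gamma> ` {1..n})"

definition min_ratio ::
  "nat \<Rightarrow> (nat \<Rightarrow> real) \<Rightarrow> (nat \<Rightarrow> nat) \<Rightarrow> (nat \<Rightarrow> nat) \<Rightarrow> (nat \<Rightarrow> nat) \<Rightarrow> real" where
  "min_ratio n x st en \<gamma> = Min (length_ratio x st en \<gamma> ` {1..n})"

end

theory Submission
  imports Defs
begin

text \<open>Measure the oscillation of \<open>f\<close> between two points by
  \<open>N(u\<^sub>1, u\<^sub>2) = \<bar>f\<^sub>1(u\<^sub>1) - f\<^sub>1(u\<^sub>2)\<bar> + \<bar>f\<^sub>2(u\<^sub>1) - f\<^sub>2(u\<^sub>2)\<bar>\<close>. If both points lie in the same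
  region and \<open>v\<^sub>1, v\<^sub>2\<close> are their preimages in the domain interval, then
  \<open>N(u\<^sub>1, u\<^sub>2) \<le> \<rho> N(v\<^sub>1, v\<^sub>2) + C \<bar>v\<^sub>1 - v\<^sub>2\<bar>\<close> with \<open>\<rho> < 1\<close>. Pulling back enlarges the
  distance by a factor between \<open>1/\<Lambda>\<close> and \<open>1/\<mu>\<close>, with \<open>\<Lambda>\<close> and \<open>\<mu>\<close> the largest and smallest length
  ratios, so \<open>N\<close> is Hoelder of every exponent \<open>\<tau>\<close> with
  \<open>\<rho> < \<mu>\<^sup>\<tau>\<close>, provided that one can always pull back. The preimages may be separated by nodes, and
  splitting there at each step would spoil the constant. But nodes are pulled back to nodes, and a
  point close to a node shares a region with it; this gives the estimate for pairs containing a
  node first. For arbitrary pairs, one splits at a node at most once.\<close>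

section \<open>Hoelder bounds from pull-backs, and elementary estimates\<close>

text \<open>Induction on the scale: a pull-back enlarges \<open>D\<close> by at least the factor
  1/\<Lambda>, so after finitely many of them \<open>D\<close> reaches \<delta> or the alternative
  with \<open>B\<close> ends the chain. The constant \<open>K\<close> survives each step because
  \<rho> * K + C is at most \<mu> powr \<tau> * K. The abstract set \<open>A\<close> lets the
  argument serve both for pairs containing a node and for all pairs.\<close>

lemma holder_bound_by_pullback:
  fixes N D :: "'a \<Rightarrow> real"
  assumes bounded: "\<And>p. p \<in> A \<Longrightarrow> N p \<le> M"
    and D_range: "\<And>p. p \<in> A \<Longrightarrow> 0 \<le> D p \<and> D p \<le> 1"
    and D_0: "\<And>p. p \<in> A \<Longrightarrow> D p = 0 \<Longrightarrow> N p \<le> 0"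
    and pull: "\<And>p. p \<in> A \<Longrightarrow> 0 < D p \<Longrightarrow> D p < \<delta> \<Longrightarrow>
      N p \<le> B * D p powr \<tau> \<or>
      (\<exists>q\<in>A. D p \<le> \<Lambda> * D q \<and> \<mu> * D q \<le> D p \<and> N p \<le> \<rho> * N q + C * D q)"
    and \<delta>: "0 < \<delta>" and \<Lambda>: "0 < \<Lambda>" "\<Lambda> < 1" and \<mu>: "0 < \<mu>"
    and \<tau>: "0 < \<tau>" "\<tau> \<le> 1" and \<rho>: "0 \<le> \<rho>" "\<rho> < \<mu> powr \<tau>" and C: "0 \<le> C"
  shows "\<exists>K>0. \<forall>p\<in>A. N p \<le> K * D p powr \<tau>"
proof -
  define w where "w = \<mu> powr \<tau>"
  have w: "\<rho> < w" "0 < w" using \<rho> \<mu> by (auto simp: w_def)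
  \<comment> \<open>The entries secure, in this order, positivity, the alternative with
    \<open>B\<close>, points with \<open>D p\<close> at least \<delta>, and the invariance
    \<open>\<rho> * K + C \<le> w * K\<close>.\<close>
  define K where "K = Max {1, B, M / \<delta> powr \<tau>, C / (w - \<rho>)}"
  have K: "1 \<le> K" "B \<le> K" "M / \<delta> powr \<tau> \<le> K" "C / (w - \<rho>) \<le> K"
    by (auto simp: K_def)
  have MK: "M \<le> K * \<delta> powr \<tau>"
    using K(3) \<delta> by (simp add: field_simps)
  have CK: "\<rho> * K + C \<le> w * K"
    using K(4) w by (simp add: field_simps)
  \<comment> \<open>Here \<open>m\<close> bounds the number of pull-backs: if \<open>p\<close> is at
    level \<open>Suc m\<close>, its pull-back is at level \<open>m\<close>.\<close>
  have *: "N p \<le> K * D p powr \<tau>" if "p \<in> A" "\<delta> * \<Lambda> ^ m \<le> D p" for p m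
    using that
  proof (induction m arbitrary: p)
    case 0
    then have "\<delta> powr \<tau> \<le> D p powr \<tau>"
      using \<delta> \<tau> by (intro powr_mono2) auto
    then have "K * \<delta> powr \<tau> \<le> K * D p powr \<tau>"
      using K(1) by (intro mult_left_mono) auto
    then show ?case
      using bounded[OF 0(1)] MK by linarith
  next
    case (Suc m)
    have pos: "0 < D p"
      using Suc.prems(2) \<delta> \<Lambda> by (smt (verit) mult_pos_pos zero_less_power)
    show ?case
    proof (cases "D p < \<delta>")
      case False
      then have "\<delta> powr \<tau> \<le> D p powr \<tau>"
        using \<delta> \<tau> by (intro powr_mono2) auto
      then have "K * \<delta> powr \<tau> \<le> K * D p powr \<tau>"
        using K(1) by (intro mult_left_mono) auto
      then show ?thesis
        using bounded[OF Suc.prems(1)] MK by linarith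
    next
      case True
      consider "N p \<le> B * D p powr \<tau>"
        | q where "q \<in> A" "D p \<le> \<Lambda> * D q" "\<mu> * D q \<le> D p" "N p \<le> \<rho> * N q + C * D q"
        using pull[OF Suc.prems(1) pos True] by blast
      then show ?thesis
      proof cases
        case 1
        have "B * D p powr \<tau> \<le> K * D p powr \<tau>"
          using K(2) by (intro mult_right_mono) auto
        with 1 show ?thesis by linarith
      next
        case (2 q)
        have "\<Lambda> * (\<delta> * \<Lambda> ^ m) \<le> \<Lambda> * D q"
          using Suc.prems(2) 2(2) by (simp add: mult_ac)
        then have "\<delta> * \<Lambda> ^ m \<le> D q"
          using \<Lambda> by simp
        from Suc.IH[OF 2(1) this] have IH: "N q \<le> K * D q powr \<tau>" .
        \<comment> \<open>As \<open>D q\<close> and \<tau> are at most 1, the linear error term is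
          absorbed into the power.\<close>
        have Dq: "D q \<le> D q powr \<tau>"
          using D_range[OF 2(1)] \<tau> powr_mono'[of \<tau> 1 "D q"] by simp
        have "w * D q powr \<tau> = (\<mu> * D q) powr \<tau>"
          using \<mu> D_range[OF 2(1)] by (simp add: w_def powr_mult)
        also have "\<dots> \<le> D p powr \<tau>"
          using 2(3) \<tau> \<mu> D_range[OF 2(1)] by (intro powr_mono2) auto
        finally have wq: "w * D q powr \<tau> \<le> D p powr \<tau>" .
        have "N p \<le> \<rho> * (K * D q powr \<tau>) + C * D q powr \<tau>"
          using 2(4) mult_left_mono[OF IH \<rho>(1)] mult_left_mono[OF Dq C] by linarith
        also have "\<dots> = (\<rho> * K + C) * D q powr \<tau>"
          by (simp add: algebra_simps)
        also have "\<dots> \<le> (w * K) * D q powr \<tau>"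
          using CK by (intro mult_right_mono) auto
        also have "\<dots> = K * (w * D q powr \<tau>)"
          by simp
        also have "\<dots> \<le> K * D p powr \<tau>"
          using wq K(1) by (intro mult_left_mono) auto
        finally show ?thesis .
      qed
    qed
  qed
  have "N p \<le> K * D p powr \<tau>" if "p \<in> A" for p
  proof (cases "D p = 0")
    case True
    then show ?thesis using D_0[OF that] by simp
  next
    case False
    then have "0 < D p / \<delta>" using D_range[OF that] \<delta> by simp
    then obtain m where "\<Lambda> ^ m < D p / \<delta>"
      using real_arch_pow_inv \<Lambda>(2) by blast
    then have "\<delta> * \<Lambda> ^ m \<le> D p"
      using \<delta> by (simp add: field_simps)
    then show ?thesis using *[OF that] by blast
  qed
  then show ?thesis using K(1) by (intro exI[of _ K]) auto
qed

text \<open>As \<tau> tends to 0 from the right, \<mu> powr \<tau> tends to 1, which exceeds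
  \<rho>.\<close>

lemma exists_exponent_powr_gt:
  fixes \<mu> \<rho> :: real
  assumes "0 < \<mu>" "\<rho> < 1"
  shows "\<exists>\<tau>. 0 < \<tau> \<and> \<tau> \<le> 1 \<and> \<rho> < \<mu> powr \<tau>"
proof -
  have "((\<lambda>\<tau>. \<mu> powr \<tau>) \<longlongrightarrow> \<mu> powr 0) (at_right 0)"
    using assms(1) by (intro tendsto_intros) auto
  then have "((\<lambda>\<tau>. \<mu> powr \<tau>) \<longlongrightarrow> 1) (at_right 0)"
    using assms(1) by simp
  then have "eventually (\<lambda>\<tau>. \<rho> < \<mu> powr \<tau>) (at_right 0)"
    using assms(2) by (rule order_tendstoD)
  moreover have "eventually (\<lambda>\<tau>::real. \<tau> < 1) (at_right 0)"
    by (rule eventually_at_right_real[of 0 1, THEN eventually_mono]) auto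
  moreover have "eventually (\<lambda>\<tau>::real. 0 < \<tau>) (at_right 0)"
    by (rule eventually_at_right_less)
  ultimately have "eventually (\<lambda>\<tau>. 0 < \<tau> \<and> \<tau> \<le> 1 \<and> \<rho> < \<mu> powr \<tau>) (at_right 0)"
    by eventually_elim auto
  then show ?thesis
    by (rule eventually_happens'[rotated]) simp
qed

text \<open>The difference is split so that changes of the values carry the unprimed coefficients
  and changes of the coefficients carry the primed values. The former yield the contraction part,
  the latter an error linear in \<open>d\<close>.\<close>

lemma abs_diff_affine_le:
  fixes a a' b b' c c' p p' q q' :: real
  assumes "\<bar>a\<bar> \<le> w" "\<bar>b\<bar> \<le> w" "\<bar>p'\<bar> \<le> M" "\<bar>q'\<bar> \<le> M"
    and "\<bar>a - a'\<bar> \<le> A * d" "\<bar>b - b'\<bar> \<le> B * d" "\<bar>c - c'\<bar> \<le> C * d"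
  shows "\<bar>(a * p + b * q + c) - (a' * p' + b' * q' + c')\<bar>
    \<le> w * (\<bar>p - p'\<bar> + \<bar>q - q'\<bar>) + (M * A + M * B + C) * d"
proof -
  have "(a * p + b * q + c) - (a' * p' + b' * q' + c')
      = a * (p - p') + b * (q - q') + (a - a') * p' + (b - b') * q' + (c - c')"
    by (simp add: algebra_simps)
  also have "\<bar>\<dots>\<bar> \<le> \<bar>a * (p - p')\<bar> + \<bar>b * (q - q')\<bar> + \<bar>(a - a') * p'\<bar> + \<bar>(b - b') * q'\<bar> + \<bar>c - c'\<bar>"
    by (intro order_trans[OF abs_triangle_ineq] add_right_mono order_refl)
  also have "\<dots> \<le> w * \<bar>p - p'\<bar> + w * \<bar>q - q'\<bar> + (A * d) * M + (B * d) * M + C * d"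
    unfolding abs_mult using assms order_trans[OF abs_ge_zero assms(5)] order_trans[OF abs_ge_zero assms(6)]
    by (intro add_mono mult_right_mono mult_mono) simp_all
  also have "\<dots> = w * (\<bar>p - p'\<bar> + \<bar>q - q'\<bar>) + (M * A + M * B + C) * d"
    by (simp add: algebra_simps)
  finally show ?thesis .
qed

section \<open>Oscillation of a plane-valued function\<close>

text \<open>The functional equation mixes both components, so they are estimated together. In the
  sum norm the contraction factors of the components add up to \<omega> plus its tilde
  variant.\<close>

definition osc :: "('a \<Rightarrow> real \<times> real) \<Rightarrow> 'a \<Rightarrow> 'a \<Rightarrow> real" where
  "osc f u v = \<bar>fst (f u) - fst (f v)\<bar> + \<bar>snd (f u) - snd (f v)\<bar>"

lemma osc_commute: "osc f u v = osc f v u"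
  by (simp add: osc_def abs_minus_commute)

lemma osc_triangle: "osc f u w \<le> osc f u v + osc f v w"
  using abs_triangle_ineq[of "fst (f u) - fst (f v)" "fst (f v) - fst (f w)"]
    abs_triangle_ineq[of "snd (f u) - snd (f v)" "snd (f v) - snd (f w)"]
  unfolding osc_def diff_add_cancel add_diff_eq by argo

lemma osc_same [simp]: "osc f u u = 0"
  by (simp add: osc_def)

section \<open>Geometry of nodes, regions and similitudes\<close>

context hv_recurrent_system
begin

lemma n_ge_2: "2 \<le> n"
  using l_ge l_le by simp

lemma x_strict: "i < j \<Longrightarrow> j \<le> n \<Longrightarrow> x i < x j"
proof (induction j)
  case (Suc j)
  then show ?case using x_less[of j] by (cases "i = j") auto
qed simp

lemma x_mono: "i \<le> j \<Longrightarrow> j \<le> n \<Longrightarrow> x i \<le> x j"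
  using x_strict[of i j] by (cases "i = j") auto

lemma x_range: "i \<le> n \<Longrightarrow> x i \<in> {0..1}"
  using x_mono[of 0 i] x_mono[of i n] x_first x_last by auto

lemma dom_subset: "i \<in> {1..n} \<Longrightarrow> dom_interval x st en (\<gamma> i) \<subseteq> {0..1}"
  using x_range[of "st (\<gamma> i)"] x_range[of "en (\<gamma> i)"] gamma_range[of i]
    st_en[of "\<gamma> i"] en_le[of "\<gamma> i"]
  by (auto simp: dom_interval_def)

lemma dom_length_pos: "i \<in> {1..n} \<Longrightarrow> x (st (\<gamma> i)) < x (en (\<gamma> i))"
  using gamma_range[of i] st_en[of "\<gamma> i"] en_le[of "\<gamma> i"] by (intro x_strict) auto

lemma region_length_pos: "i \<in> {1..n} \<Longrightarrow> x (i - 1) < x i"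
  by (intro x_strict) auto

lemma L_dist:
  assumes i: "i \<in> {1..n}" and "u \<in> dom_interval x st en (\<gamma> i)" "v \<in> dom_interval x st en (\<gamma> i)"
  shows "\<bar>L i (\<gamma> i) u - L i (\<gamma> i) v\<bar> = length_ratio x st en \<gamma> i * \<bar>u - v\<bar>"
    and "0 < length_ratio x st en \<gamma> i" and "length_ratio x st en \<gamma> i < 1"
proof -
  obtain c where c: "0 < c" "c < 1" and
    sim: "\<And>u v. u \<in> dom_interval x st en (\<gamma> i) \<Longrightarrow> v \<in> dom_interval x st en (\<gamma> i) \<Longrightarrow>
      \<bar>L i (\<gamma> i) u - L i (\<gamma> i) v\<bar> = c * \<bar>u - v\<bar>"
    using L_simil[OF i] by (auto simp: contractive_similitude_def dist_real_def)
  let ?a = "x (st (\<gamma> i))" and ?b = "x (en (\<gamma> i))"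
  have ab: "?a < ?b" using dom_length_pos[OF i] .
  \<comment> \<open>The similitude may preserve or reverse the orientation; the absolute value
    covers both cases. Comparing the endpoint distances identifies its factor \<open>c\<close> with
    the length ratio.\<close>
  have "\<bar>L i (\<gamma> i) ?b - L i (\<gamma> i) ?a\<bar> = x i - x (i - 1)"
    using L_ends[OF i] region_length_pos[OF i] by (auto simp: doubleton_eq_iff)
  moreover have "\<bar>L i (\<gamma> i) ?b - L i (\<gamma> i) ?a\<bar> = c * (?b - ?a)"
    using sim[of ?b ?a] ab by (auto simp: dom_interval_def)
  ultimately have "length_ratio x st en \<gamma> i = c"
    using ab by (simp add: length_ratio_def field_simps)
  then show "\<bar>L i (\<gamma> i) u - L i (\<gamma> i) v\<bar> = length_ratio x st en \<gamma> i * \<bar>u - v\<bar>"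
    "0 < length_ratio x st en \<gamma> i" "length_ratio x st en \<gamma> i < 1"
    using sim assms c by auto
qed

lemma length_ratio_range:
  assumes "i \<in> {1..n}"
  shows "0 < length_ratio x st en \<gamma> i" "length_ratio x st en \<gamma> i < 1"
  using L_dist(2,3)[OF assms, of "x (st (\<gamma> i))" "x (st (\<gamma> i))"] dom_length_pos[OF assms]
  by (auto simp: dom_interval_def)

lemma min_ratio_le: "i \<in> {1..n} \<Longrightarrow> min_ratio n x st en \<gamma> \<le> length_ratio x st en \<gamma> i"
  by (simp add: min_ratio_def)

lemma max_ratio_ge: "i \<in> {1..n} \<Longrightarrow> length_ratio x st en \<gamma> i \<le> max_ratio n x st en \<gamma>"
  by (simp add: max_ratio_def)

lemma ratio_range:
  "0 < min_ratio n x st en \<gamma>" "min_ratio n x st en \<gamma> \<le> max_ratio n x st en \<gamma>"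
  "max_ratio n x st en \<gamma> < 1"
proof -
  have ne: "{1..n} \<noteq> {}" using n_ge_2 by simp
  show "0 < min_ratio n x st en \<gamma>"
    unfolding min_ratio_def using ne length_ratio_range(1) by (subst Min_gr_iff) auto
  show "max_ratio n x st en \<gamma> < 1"
    unfolding max_ratio_def using ne length_ratio_range(2) by (subst Max_less_iff) auto
  show "min_ratio n x st en \<gamma> \<le> max_ratio n x st en \<gamma>"
    using min_ratio_le[of 1] max_ratio_ge[of 1] n_ge_2 by fastforce
qed

lemma L_image: "i \<in> {1..n} \<Longrightarrow> L i (\<gamma> i) ` dom_interval x st en (\<gamma> i) = region x i"
  using L_homeo[of i] by (auto simp only: homeomorphism_def)

lemma L_inj: "i \<in> {1..n} \<Longrightarrow> inj_on (L i (\<gamma> i)) (dom_interval x st en (\<gamma> i))"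
  using L_dist(1,2)[of i] by (intro inj_onI) fastforce

text \<open>Endpoints of a region come from endpoints of the domain interval, which are nodes again.
  This keeps the pairs containing a node closed under pulling back.\<close>

lemma node_preimage:
  assumes "i \<in> {1..n}" "a \<in> {i - 1, i}"
  obtains \<alpha> where "\<alpha> \<le> n" "x \<alpha> \<in> dom_interval x st en (\<gamma> i)" "L i (\<gamma> i) (x \<alpha>) = x a"
proof -
  have "x a \<in> L i (\<gamma> i) ` {x (st (\<gamma> i)), x (en (\<gamma> i))}"
    unfolding L_ends[OF assms(1)] using assms(2) by blast
  then have "L i (\<gamma> i) (x (st (\<gamma> i))) = x a \<or> L i (\<gamma> i) (x (en (\<gamma> i))) = x a"
    by (simp only: image_insert image_empty insert_iff empty_iff simp_thms eq_commute)
  then obtain \<alpha> where \<alpha>: "\<alpha> = st (\<gamma> i) \<or> \<alpha> = en (\<gamma> i)" "L i (\<gamma> i) (x \<alpha>) = x a"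
    by metis
  have "st (\<gamma> i) \<le> n" "en (\<gamma> i) \<le> n"
    using st_en[OF gamma_range[OF assms(1)]] en_le[OF gamma_range[OF assms(1)]] by auto
  then have "\<alpha> \<le> n"
    using \<alpha>(1) by blast
  moreover have "x \<alpha> \<in> dom_interval x st en (\<gamma> i)"
    using \<alpha>(1) less_imp_le[OF dom_length_pos[OF assms(1)]]
    unfolding dom_interval_def atLeastAtMost_iff by blast
  ultimately show ?thesis using that \<alpha>(2) by blast
qed

lemma region_cover:
  assumes "u \<in> {0..1}"
  obtains i where "i \<in> {1..n}" "u \<in> region x i"
proof (cases "u = 0")
  case True
  then have "u \<in> region x 1"
    using x_first x_strict[of 0 1] n_ge_2 by (auto simp: region_def)
  then show ?thesis using that[of 1] n_ge_2 by auto
next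
  case False
  \<comment> \<open>The first node not left of \<open>u\<close> closes the region sought. The point
    0 is treated apart, since there the least index is 0 and numbers no region.\<close>
  define i where "i = (LEAST i. u \<le> x i)"
  have "u \<le> x n" using assms x_last by simp
  then have "u \<le> x i" "i \<le> n"
    unfolding i_def by (rule LeastI, rule Least_le)
  moreover have "i \<noteq> 0"
    using \<open>u \<le> x i\<close> x_first assms False by (intro notI) auto
  moreover have "\<not> u \<le> x (i - 1)"
    using \<open>i \<noteq> 0\<close> not_less_Least[of "i - 1" "\<lambda>i. u \<le> x i"] unfolding i_def by auto
  ultimately show ?thesis using that[of i] by (auto simp: region_def)
qed

text \<open>With \<delta> the shortest region length, a point closer than \<delta> to a node cannot
  pass beyond either adjacent region.\<close>

lemma node_neighbour_region:
  "\<exists>\<delta>>0. \<forall>j\<le>n. \<forall>v\<in>{0..1}. \<bar>x j - v\<bar> < \<delta> \<longrightarrow>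
    (\<exists>i\<in>{1..n}. j \<in> {i - 1, i} \<and> v \<in> region x i)"
proof -
  define \<delta> where "\<delta> = Min ((\<lambda>i. x i - x (i - 1)) ` {1..n})"
  have pos: "0 < \<delta>"
    unfolding \<delta>_def using n_ge_2 region_length_pos by (subst Min_gr_iff) auto
  have le: "\<delta> \<le> x i - x (i - 1)" if "i \<in> {1..n}" for i
    unfolding \<delta>_def using that by (intro Min_le) auto
  have "\<exists>i\<in>{1..n}. j \<in> {i - 1, i} \<and> v \<in> region x i"
    if "j \<le> n" "v \<in> {0..1}" "\<bar>x j - v\<bar> < \<delta>" for j v
  \<comment> \<open>Region \<open>Suc j\<close> is used for points to the right of the node, region
    \<open>j\<close> for points to its left; at node 0 only the former exists, at node
    \<open>n\<close> only the latter.\<close>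
  proof (cases "j < n \<and> x j \<le> v \<or> j = 0")
    case True
    then have "j < n" using n_ge_2 by auto
    then show ?thesis
      using True le[of "Suc j"] that x_first
      by (intro bexI[of _ "Suc j"]) (auto simp: region_def)
  next
    case False
    then have "v \<le> x j" "0 < j" using that x_last by (cases "j = n"; force)+
    then show ?thesis
      using le[of j] that by (intro bexI[of _ j]) (auto simp: region_def)
  qed
  with pos show ?thesis by blast
qed

section \<open>Bounds and Lipschitz estimates for the factors and additive terms\<close>

lemma abs_le_sup_abs:
  assumes "i \<in> {1..n}" "g \<in> {s i, s' i, t i, t' i}" "u \<in> region x i"
  shows "\<bar>g u\<bar> \<le> sup_abs (region x i) g"
  unfolding sup_abs_def
  using factor_less_1[OF assms(1,2)] assms(3)
  by (intro cSUP_upper bdd_aboveI2[of _ _ 1]) (auto intro: less_imp_le)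

lemma factor_le_omega:
  assumes "i \<in> {1..n}" "u \<in> region x i"
  shows "\<bar>s i u\<bar> \<le> omega x s s' i" "\<bar>s' i u\<bar> \<le> omega x s s' i"
    "\<bar>t i u\<bar> \<le> omega x t t' i" "\<bar>t' i u\<bar> \<le> omega x t t' i"
  using assms abs_le_sup_abs[of i "s i" u] abs_le_sup_abs[of i "s' i" u]
    abs_le_sup_abs[of i "t i" u] abs_le_sup_abs[of i "t' i" u]
  by (auto simp: omega_def)

lemma omega_nonneg: "i \<in> {1..n} \<Longrightarrow> 0 \<le> omega x s s' i" "i \<in> {1..n} \<Longrightarrow> 0 \<le> omega x t t' i"
  using factor_le_omega[of i "x i"] region_length_pos[of i] by (auto simp: region_def)

text \<open>The similitude shrinks distances, so a Lipschitz constant on the region also serves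
  after composition with it.\<close>

lemma factor_pullback_lipschitz:
  assumes i: "i \<in> {1..n}" and g: "g \<in> {s i, s' i, t i, t' i}"
  shows "\<exists>C\<ge>0. \<forall>u\<in>dom_interval x st en (\<gamma> i). \<forall>v\<in>dom_interval x st en (\<gamma> i).
    \<bar>g (L i (\<gamma> i) u) - g (L i (\<gamma> i) v)\<bar> \<le> C * \<bar>u - v\<bar>"
proof -
  obtain C where C: "C-lipschitz_on (region x i) g"
    using factor_lipschitz[OF i g] by (auto simp: lipschitz_def)
  have "\<bar>g (L i (\<gamma> i) u) - g (L i (\<gamma> i) v)\<bar> \<le> C * \<bar>u - v\<bar>"
    if uv: "u \<in> dom_interval x st en (\<gamma> i)" "v \<in> dom_interval x st en (\<gamma> i)" for u v
  proof -
    have "\<bar>g (L i (\<gamma> i) u) - g (L i (\<gamma> i) v)\<bar> \<le> C * \<bar>L i (\<gamma> i) u - L i (\<gamma> i) v\<bar>"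
      using lipschitz_onD[OF C] L_image[OF i] uv by (auto simp: dist_real_def)
    also have "\<bar>L i (\<gamma> i) u - L i (\<gamma> i) v\<bar> \<le> 1 * \<bar>u - v\<bar>"
      unfolding L_dist(1)[OF i uv] using length_ratio_range[OF i] by (intro mult_right_mono) auto
    finally show ?thesis
      using lipschitz_on_nonneg[OF C] by (simp add: mult_left_mono)
  qed
  then show ?thesis using lipschitz_on_nonneg[OF C] by blast
qed

lemma term_lipschitz_bound:
  assumes i: "i \<in> {1..n}" and g: "g \<in> {q i (\<gamma> i), r i (\<gamma> i)}"
  shows "\<exists>C\<ge>0. \<forall>u\<in>dom_interval x st en (\<gamma> i). \<forall>v\<in>dom_interval x st en (\<gamma> i).
    \<bar>g u - g v\<bar> \<le> C * \<bar>u - v\<bar>"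
  using term_lipschitz[OF i g] unfolding lipschitz_def lipschitz_on_def dist_real_def by blast

end

section \<open>One-step oscillation estimate for the interpolation function\<close>

context hv_recurrent_fif
begin

lemma f_bounded: "\<exists>M\<ge>0. \<forall>u\<in>{0..1}. \<bar>fst (f u)\<bar> \<le> M \<and> \<bar>snd (f u)\<bar> \<le> M"
proof -
  have "bounded (f ` {0..1})"
    using f_cont by (intro compact_imp_bounded compact_continuous_image) auto
  then obtain M where M: "\<And>u. u \<in> {0..1} \<Longrightarrow> norm (f u) \<le> M"
    unfolding bounded_iff by blast
  have "\<bar>fst (f u)\<bar> \<le> M" "\<bar>snd (f u)\<bar> \<le> M" if "u \<in> {0..1}" for u
    using M[OF that] norm_fst_le[of "fst (f u)" "snd (f u)"] norm_snd_le[of "snd (f u)" "fst (f u)"]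
    by auto
  moreover have "0 \<le> M" using M[of 0] norm_ge_zero[of "f 0"] by (simp del: norm_ge_zero)
  ultimately show ?thesis by blast
qed

text \<open>The functional equation in forward form: injectivity of the similitude removes
  \<open>inv_into\<close>.\<close>

lemma f_L:
  assumes i: "i \<in> {1..n}" and v: "v \<in> dom_interval x st en (\<gamma> i)"
  shows "f (L i (\<gamma> i) v) =
    hv_map (L i (\<gamma> i)) (s i) (s' i) (t i) (t' i) (q i (\<gamma> i)) (r i (\<gamma> i)) v (f v)"
proof -
  have "L i (\<gamma> i) v \<in> region x i" using L_image[OF i] v by auto
  from f_eq[OF i this] show ?thesis
    by (simp add: inv_into_f_f[OF L_inj[OF i] v] Let_def)
qed

text \<open>Each component is an instance of \<open>abs_diff_affine_le\<close>, with its own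
  \<open>omega\<close> as coefficient bound and a common bound \<open>M\<close> on the values of
  \<open>f\<close>. Adding the two instances gives the claim.\<close>

lemma osc_L_le:
  assumes i: "i \<in> {1..n}"
  shows "\<exists>C\<ge>0. \<forall>u\<in>dom_interval x st en (\<gamma> i). \<forall>v\<in>dom_interval x st en (\<gamma> i).
    osc f (L i (\<gamma> i) u) (L i (\<gamma> i) v)
      \<le> (omega x s s' i + omega x t t' i) * osc f u v + C * \<bar>u - v\<bar>"
proof -
  let ?I = "dom_interval x st en (\<gamma> i)" and ?L = "L i (\<gamma> i)"
  obtain M where M: "0 \<le> M" "\<And>u. u \<in> {0..1} \<Longrightarrow> \<bar>fst (f u)\<bar> \<le> M \<and> \<bar>snd (f u)\<bar> \<le> M"
    using f_bounded by blast
  obtain A where A: "A \<ge> 0" "\<And>u v. u \<in> ?I \<Longrightarrow> v \<in> ?I \<Longrightarrow> \<bar>s i (?L u) - s i (?L v)\<bar> \<le> A * \<bar>u - v\<bar>"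
    using factor_pullback_lipschitz[OF i, of "s i"] by auto
  obtain A' where A': "A' \<ge> 0" "\<And>u v. u \<in> ?I \<Longrightarrow> v \<in> ?I \<Longrightarrow> \<bar>s' i (?L u) - s' i (?L v)\<bar> \<le> A' * \<bar>u - v\<bar>"
    using factor_pullback_lipschitz[OF i, of "s' i"] by auto
  obtain B where B: "B \<ge> 0" "\<And>u v. u \<in> ?I \<Longrightarrow> v \<in> ?I \<Longrightarrow> \<bar>t i (?L u) - t i (?L v)\<bar> \<le> B * \<bar>u - v\<bar>"
    using factor_pullback_lipschitz[OF i, of "t i"] by auto
  obtain B' where B': "B' \<ge> 0" "\<And>u v. u \<in> ?I \<Longrightarrow> v \<in> ?I \<Longrightarrow> \<bar>t' i (?L u) - t' i (?L v)\<bar> \<le> B' * \<bar>u - v\<bar>"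
    using factor_pullback_lipschitz[OF i, of "t' i"] by auto
  obtain Q where Q: "Q \<ge> 0" "\<And>u v. u \<in> ?I \<Longrightarrow> v \<in> ?I \<Longrightarrow> \<bar>q i (\<gamma> i) u - q i (\<gamma> i) v\<bar> \<le> Q * \<bar>u - v\<bar>"
    using term_lipschitz_bound[OF i, of "q i (\<gamma> i)"] by auto
  obtain R where R: "R \<ge> 0" "\<And>u v. u \<in> ?I \<Longrightarrow> v \<in> ?I \<Longrightarrow> \<bar>r i (\<gamma> i) u - r i (\<gamma> i) v\<bar> \<le> R * \<bar>u - v\<bar>"
    using term_lipschitz_bound[OF i, of "r i (\<gamma> i)"] by auto
  define C where "C = (M * A + M * A' + Q) + (M * B + M * B' + R)"
  have "osc f (?L u) (?L v) \<le> (omega x s s' i + omega x t t' i) * osc f u v + C * \<bar>u - v\<bar>"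
    if uv: "u \<in> ?I" "v \<in> ?I" for u v
  proof -
    have Lu: "?L u \<in> region x i" using L_image[OF i] uv by auto
    have v01: "v \<in> {0..1}" using dom_subset[OF i] uv by auto
    have "\<bar>fst (f (?L u)) - fst (f (?L v))\<bar>
        \<le> omega x s s' i * osc f u v + (M * A + M * A' + Q) * \<bar>u - v\<bar>"
      unfolding f_L[OF i uv(1)] f_L[OF i uv(2)] hv_map_def fst_conv osc_def
      using uv M(2)[OF v01] factor_le_omega[OF i Lu]
      by (intro abs_diff_affine_le A(2) A'(2) Q(2)) auto
    moreover have "\<bar>snd (f (?L u)) - snd (f (?L v))\<bar>
        \<le> omega x t t' i * osc f u v + (M * B + M * B' + R) * \<bar>u - v\<bar>"
      unfolding f_L[OF i uv(1)] f_L[OF i uv(2)] hv_map_def snd_conv osc_def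
      using uv M(2)[OF v01] factor_le_omega[OF i Lu]
      by (intro abs_diff_affine_le B(2) B'(2) R(2)) auto
    ultimately show ?thesis
      unfolding osc_def[of f "?L u"] C_def by (simp add: algebra_simps)
  qed
  moreover have "0 \<le> C" using M(1) A(1) A'(1) B(1) B'(1) Q(1) R(1) by (simp add: C_def)
  ultimately show ?thesis by blast
qed

lemma osc_L_le_uniform:
  assumes \<rho>: "\<And>i. i \<in> {1..n} \<Longrightarrow> omega x s s' i + omega x t t' i \<le> \<rho>"
  shows "\<exists>C\<ge>0. \<forall>i\<in>{1..n}. \<forall>u\<in>dom_interval x st en (\<gamma> i). \<forall>v\<in>dom_interval x st en (\<gamma> i).
    osc f (L i (\<gamma> i) u) (L i (\<gamma> i) v) \<le> \<rho> * osc f u v + C * \<bar>u - v\<bar>"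
proof -
  have *: "\<forall>i\<in>{1..n}. \<exists>C. 0 \<le> C \<and>
      (\<forall>u\<in>dom_interval x st en (\<gamma> i). \<forall>v\<in>dom_interval x st en (\<gamma> i).
        osc f (L i (\<gamma> i) u) (L i (\<gamma> i) v)
          \<le> (omega x s s' i + omega x t t' i) * osc f u v + C * \<bar>u - v\<bar>)"
    using osc_L_le by blast
  obtain C where C: "\<And>i. i \<in> {1..n} \<Longrightarrow> 0 \<le> C i"
    "\<And>i u v. i \<in> {1..n} \<Longrightarrow> u \<in> dom_interval x st en (\<gamma> i) \<Longrightarrow> v \<in> dom_interval x st en (\<gamma> i) \<Longrightarrow>
      osc f (L i (\<gamma> i) u) (L i (\<gamma> i) v)
        \<le> (omega x s s' i + omega x t t' i) * osc f u v + C i * \<bar>u - v\<bar>"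
    using bchoice[OF *] by blast
  \<comment> \<open>The sum of the finitely many nonnegative constants dominates each of
    them.\<close>
  define C' where "C' = sum C {1..n}"
  have C': "C i \<le> C'" if "i \<in> {1..n}" for i
    unfolding C'_def using that C(1) by (intro member_le_sum) auto
  have "osc f (L i (\<gamma> i) u) (L i (\<gamma> i) v) \<le> \<rho> * osc f u v + C' * \<bar>u - v\<bar>"
    if "i \<in> {1..n}" "u \<in> dom_interval x st en (\<gamma> i)" "v \<in> dom_interval x st en (\<gamma> i)" for i u v
  proof -
    have "(omega x s s' i + omega x t t' i) * osc f u v \<le> \<rho> * osc f u v"
      using \<rho>[OF that(1)] by (intro mult_right_mono) (auto simp: osc_def)
    moreover have "C i * \<bar>u - v\<bar> \<le> C' * \<bar>u - v\<bar>"
      using C'[OF that(1)] by (intro mult_right_mono) auto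
    ultimately show ?thesis using C(2)[OF that] by linarith
  qed
  moreover have "0 \<le> C'" unfolding C'_def using C(1) by (intro sum_nonneg) auto
  ultimately show ?thesis by blast
qed

section \<open>Hoelder estimate for the oscillation\<close>

lemma osc_holder:
  assumes \<rho>: "\<And>i. i \<in> {1..n} \<Longrightarrow> omega x s s' i + omega x t t' i \<le> \<rho>"
    and \<tau>: "0 < \<tau>" "\<tau> \<le> 1" "\<rho> < min_ratio n x st en \<gamma> powr \<tau>"
  shows "\<exists>K>0. \<forall>u\<in>{0..1}. \<forall>v\<in>{0..1}. osc f u v \<le> K * \<bar>u - v\<bar> powr \<tau>"
proof -
  let ?\<mu> = "min_ratio n x st en \<gamma>" and ?\<Lambda> = "max_ratio n x st en \<gamma>"
  let ?N = "\<lambda>(u, v). osc f u v" and ?D = "\<lambda>(u, v). \<bar>u - v\<bar> :: real"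
  have \<rho>0: "0 \<le> \<rho>"
    using \<rho>[of 1] omega_nonneg[of 1] n_ge_2 by fastforce
  have \<Lambda>0: "0 < ?\<Lambda>" using ratio_range by linarith
  obtain C where C: "0 \<le> C"
    "\<And>i u v. i \<in> {1..n} \<Longrightarrow> u \<in> dom_interval x st en (\<gamma> i) \<Longrightarrow> v \<in> dom_interval x st en (\<gamma> i) \<Longrightarrow>
      osc f (L i (\<gamma> i) u) (L i (\<gamma> i) v) \<le> \<rho> * osc f u v + C * \<bar>u - v\<bar>"
    using osc_L_le_uniform[OF \<rho>] by blast
  have pull: "\<bar>L i (\<gamma> i) u - L i (\<gamma> i) v\<bar> \<le> ?\<Lambda> * \<bar>u - v\<bar>"
    "?\<mu> * \<bar>u - v\<bar> \<le> \<bar>L i (\<gamma> i) u - L i (\<gamma> i) v\<bar>"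
    if "i \<in> {1..n}" "u \<in> dom_interval x st en (\<gamma> i)" "v \<in> dom_interval x st en (\<gamma> i)" for i u v
    unfolding L_dist(1)[OF that] using min_ratio_le[OF that(1)] max_ratio_ge[OF that(1)]
    by (auto intro: mult_right_mono)
  obtain M where M: "\<And>u. u \<in> {0..1} \<Longrightarrow> \<bar>fst (f u)\<bar> \<le> M \<and> \<bar>snd (f u)\<bar> \<le> M"
    using f_bounded by blast
  have bdd: "osc f u v \<le> 4 * M" if "u \<in> {0..1}" "v \<in> {0..1}" for u v
    using M[OF that(1)] M[OF that(2)]
      abs_triangle_ineq4[of "fst (f u)" "fst (f v)"] abs_triangle_ineq4[of "snd (f u)" "snd (f v)"]
    unfolding osc_def by argo
  obtain \<delta> where \<delta>: "0 < \<delta>" "\<And>j v. j \<le> n \<Longrightarrow> v \<in> {0..1} \<Longrightarrow> \<bar>x j - v\<bar> < \<delta> \<Longrightarrow>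
      \<exists>i\<in>{1..n}. j \<in> {i - 1, i} \<and> v \<in> region x i"
    using node_neighbour_region by blast
  \<comment> \<open>First application: pairs containing a node. Such a pair at distance below
    \<delta> lies in one region and pulls back to a pair containing a node, so no terminating
    alternative occurs and \<open>B\<close> is 0.\<close>
  have "\<exists>K>0. \<forall>p\<in>x ` {..n} \<times> {0..1}. ?N p \<le> K * ?D p powr \<tau>"
  proof (rule holder_bound_by_pullback[where M = "4 * M" and B = 0 and \<delta> = \<delta>
        and \<Lambda> = ?\<Lambda> and \<mu> = ?\<mu> and \<rho> = \<rho> and C = C])
    fix p assume p: "p \<in> x ` {..n} \<times> {0..1}" "?D p < \<delta>"
    then obtain j v where jv: "p = (x j, v)" "j \<le> n" "v \<in> {0..1}" "\<bar>x j - v\<bar> < \<delta>" by auto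
    obtain i where i: "i \<in> {1..n}" "j \<in> {i - 1, i}" "v \<in> region x i"
      using \<delta>(2)[OF jv(2-4)] by blast
    obtain \<alpha> where \<alpha>: "\<alpha> \<le> n" "x \<alpha> \<in> dom_interval x st en (\<gamma> i)" "L i (\<gamma> i) (x \<alpha>) = x j"
      using node_preimage[OF i(1,2)] by blast
    obtain v' where v': "v' \<in> dom_interval x st en (\<gamma> i)" "L i (\<gamma> i) v' = v"
      using L_image[OF i(1)] i(3) by (metis imageE)
    have "(x \<alpha>, v') \<in> x ` {..n} \<times> {0..1}"
      using \<alpha>(1) v'(1) dom_subset[OF i(1)] by auto
    moreover note pull[OF i(1) \<alpha>(2) v'(1)] C(2)[OF i(1) \<alpha>(2) v'(1)]
    ultimately show "?N p \<le> 0 * ?D p powr \<tau> \<or> (\<exists>q\<in>x ` {..n} \<times> {0..1}.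
        ?D p \<le> ?\<Lambda> * ?D q \<and> ?\<mu> * ?D q \<le> ?D p \<and> ?N p \<le> \<rho> * ?N q + C * ?D q)"
      unfolding jv(1) \<alpha>(3) v'(2) by (intro disjI2 bexI[of _ "(x \<alpha>, v')"]) auto
  next
    fix p assume "p \<in> x ` {..n} \<times> {0..1::real}"
    then obtain u v where p: "p = (u, v)" and uv: "u \<in> {0..1}" "v \<in> {0..1}"
      using x_range by blast
    show "?N p \<le> 4 * M" using bdd[OF uv] by (simp add: p)
    show "0 \<le> ?D p \<and> ?D p \<le> 1" using uv by (simp add: p abs_le_iff)
    show "?N p \<le> 0" if "?D p = 0" using that by (simp add: p)
  qed (fact \<delta>(1) \<Lambda>0 ratio_range \<tau> \<rho>0 C(1))+
  then obtain K where K: "0 < K"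
    "\<And>j v. j \<le> n \<Longrightarrow> v \<in> {0..1} \<Longrightarrow> osc f (x j) v \<le> K * \<bar>x j - v\<bar> powr \<tau>"
    by force
  \<comment> \<open>Either \<open>u\<close> and \<open>v\<close> share region \<open>i\<close> and
    can be pulled back, or the node \<open>x i\<close> separates them. In the second case the node
    estimate applies on both sides and the chain ends, which gives the constant
    \<open>2 * K\<close>.\<close>
  have step: "osc f u v \<le> 2 * K * \<bar>u - v\<bar> powr \<tau> \<or>
      (\<exists>u'\<in>{0..1}. \<exists>v'\<in>{0..1}. \<bar>u - v\<bar> \<le> ?\<Lambda> * \<bar>u' - v'\<bar> \<and> ?\<mu> * \<bar>u' - v'\<bar> \<le> \<bar>u - v\<bar> \<and>
        osc f u v \<le> \<rho> * osc f u' v' + C * \<bar>u' - v'\<bar>)"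
    if uv: "u \<in> {0..1}" "v \<in> {0..1}" "u \<le> v" for u v
  proof -
    obtain i where i: "i \<in> {1..n}" "u \<in> region x i"
      using region_cover[OF uv(1)] .
    show ?thesis
    proof (cases "v \<le> x i")
      case True
      then have "v \<in> region x i" using i(2) uv(3) by (auto simp: region_def)
      then obtain u' v' where
        u': "u' \<in> dom_interval x st en (\<gamma> i)" "L i (\<gamma> i) u' = u" and
        v': "v' \<in> dom_interval x st en (\<gamma> i)" "L i (\<gamma> i) v' = v"
        using L_image[OF i(1)] i(2) by (metis imageE)
      show ?thesis
        using pull[OF i(1) u'(1) v'(1)] C(2)[OF i(1) u'(1) v'(1)] dom_subset[OF i(1)] u' v'
        by blast
    next
      case False
      \<comment> \<open>The node lies between \<open>u\<close> and \<open>v\<close>, so neither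
        distance to it exceeds their own.\<close>
      have le: "\<bar>x i - w\<bar> powr \<tau> \<le> \<bar>u - v\<bar> powr \<tau>" if "w \<in> {u, v}" for w
        using that i(2) False uv(3) \<tau>(1) by (intro powr_mono2) (auto simp: region_def)
      have "osc f u v \<le> osc f (x i) u + osc f (x i) v"
        using osc_triangle[of f u v "x i"] by (simp add: osc_commute)
      also have "\<dots> \<le> K * \<bar>x i - u\<bar> powr \<tau> + K * \<bar>x i - v\<bar> powr \<tau>"
        using K(2) uv i(1) by (intro add_mono) auto
      also have "\<dots> \<le> K * \<bar>u - v\<bar> powr \<tau> + K * \<bar>u - v\<bar> powr \<tau>"
        using K(1) le by (intro add_mono mult_left_mono) auto
      finally show ?thesis by simp
    qed
  qed
  have step_sym: "osc f u v \<le> 2 * K * \<bar>u - v\<bar> powr \<tau> \<or>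
      (\<exists>u'\<in>{0..1}. \<exists>v'\<in>{0..1}. \<bar>u - v\<bar> \<le> ?\<Lambda> * \<bar>u' - v'\<bar> \<and> ?\<mu> * \<bar>u' - v'\<bar> \<le> \<bar>u - v\<bar> \<and>
        osc f u v \<le> \<rho> * osc f u' v' + C * \<bar>u' - v'\<bar>)"
    if uv: "u \<in> {0..1}" "v \<in> {0..1}" for u v
    using step[OF uv] step[OF uv(2,1)]
    by (cases "u \<le> v") (simp_all add: osc_commute[of f v u] abs_minus_commute[of v u])
  \<comment> \<open>Second application: all pairs. The dichotomy \<open>step_sym\<close> holds at
    every distance, so \<delta> can be 1.\<close>
  have "\<exists>K>0. \<forall>p\<in>{0..1} \<times> {0..1}. ?N p \<le> K * ?D p powr \<tau>"
  proof (rule holder_bound_by_pullback[where M = "4 * M" and B = "2 * K" and \<delta> = 1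
        and \<Lambda> = ?\<Lambda> and \<mu> = ?\<mu> and \<rho> = \<rho> and C = C])
    fix p assume "p \<in> {0..1::real} \<times> {0..1::real}"
    then obtain u v where "p = (u, v)" "u \<in> {0..1}" "v \<in> {0..1}" by auto
    then show "?N p \<le> 2 * K * ?D p powr \<tau> \<or> (\<exists>q\<in>{0..1} \<times> {0..1}.
        ?D p \<le> ?\<Lambda> * ?D q \<and> ?\<mu> * ?D q \<le> ?D p \<and> ?N p \<le> \<rho> * ?N q + C * ?D q)"
      using step_sym[of u v] by fastforce
  next
    fix p assume "p \<in> {0..1::real} \<times> {0..1::real}"
    then obtain u v where p: "p = (u, v)" and uv: "u \<in> {0..1}" "v \<in> {0..1}"
      by blast
    show "?N p \<le> 4 * M" using bdd[OF uv] by (simp add: p)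
    show "0 \<le> ?D p \<and> ?D p \<le> 1" using uv by (simp add: p abs_le_iff)
    show "?N p \<le> 0" if "?D p = 0" using that by (simp add: p)
  qed (fact zero_less_one \<Lambda>0 ratio_range \<tau> \<rho>0 C(1))+
  then show ?thesis by force
qed

end

section \<open>Choice of the exponent and conclusion\<close>

theorem theorem3:
  fixes n l :: nat
    and x y z :: "nat \<Rightarrow> real"
    and st en \<gamma> :: "nat \<Rightarrow> nat"
    and L q r :: "nat \<Rightarrow> nat \<Rightarrow> real \<Rightarrow> real"
    and s s' t t' :: "nat \<Rightarrow> real \<Rightarrow> real"
    and f :: "real \<Rightarrow> real \<times> real"
  assumes "hv_recurrent_fif n x y z l st en \<gamma> L s s' t t' q r f"
    and "\<And>k. k \<in> {1..n} \<Longrightarrow>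
      omega x s s' k + omega x t t' k < min_ratio n x st en \<gamma> / max_ratio n x st en \<gamma>"
  shows "\<exists>L1 L2 \<tau>1 \<tau>2. 0 < L1 \<and> 0 < L2 \<and> 0 < \<tau>1 \<and> \<tau>1 \<le> 1 \<and> 0 < \<tau>2 \<and> \<tau>2 \<le> 1 \<and>
    (\<forall>x1\<in>{0..1}. \<forall>x2\<in>{0..1}.
      \<bar>fst (f x1) - fst (f x2)\<bar> \<le> L1 * \<bar>x1 - x2\<bar> powr \<tau>1 \<and>
      \<bar>snd (f x1) - snd (f x2)\<bar> \<le> L2 * \<bar>x1 - x2\<bar> powr \<tau>2)"
proof -
  interpret hv_recurrent_fif n x y z l st en \<gamma> L s s' t t' q r f by fact
  define \<rho> where "\<rho> = Max ((\<lambda>k. omega x s s' k + omega x t t' k) ` {1..n})"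
  have \<rho>_ge: "omega x s s' i + omega x t t' i \<le> \<rho>" if "i \<in> {1..n}" for i
    unfolding \<rho>_def using that by (intro Max_ge) auto
  \<comment> \<open>Since the smallest ratio is at most the largest, the hypothesis forces each sum
    of factors below 1, hence also their finite maximum \<rho>.\<close>
  have "min_ratio n x st en \<gamma> / max_ratio n x st en \<gamma> \<le> 1"
    using ratio_range by simp
  then have "\<rho> < 1"
    unfolding \<rho>_def using n_ge_2 assms(2) by (subst Max_less_iff) fastforce+
  then obtain \<tau> where \<tau>: "0 < \<tau>" "\<tau> \<le> 1" "\<rho> < min_ratio n x st en \<gamma> powr \<tau>"
    using exists_exponent_powr_gt ratio_range(1) by blast
  obtain K where K: "0 < K" "\<And>u v. u \<in> {0..1} \<Longrightarrow> v \<in> {0..1} \<Longrightarrow> osc f u v \<le> K * \<bar>u - v\<bar> powr \<tau>"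
    using osc_holder[OF \<rho>_ge \<tau>] by blast
  have "\<bar>fst (f u) - fst (f v)\<bar> \<le> K * \<bar>u - v\<bar> powr \<tau>"
    "\<bar>snd (f u) - snd (f v)\<bar> \<le> K * \<bar>u - v\<bar> powr \<tau>" if "u \<in> {0..1}" "v \<in> {0..1}" for u v
    using K(2)[OF that] unfolding osc_def by linarith+
  then show ?thesis
    \<comment> \<open>Each component difference is bounded by \<open>osc\<close>, so one constant
      and one exponent serve for both.\<close>
    using K(1) \<tau> by (intro exI[of _ K] exI[of _ \<tau>]) auto
qed

end
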